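(* Let $n>k\ge1$ be odd coprime integers, $A=\Bbbk_{-1}[u,v]$ and $G=G_{n,k}$. Write the Hirzebruch–Jung continued fraction $\frac{2n}{n+k}=[\gamma_1,\dots,\gamma_{d-1}]$ (so $\gamma_1=2$, $d\ge3$), and set $\beta_3=\gamma_3+1$ (if $d\ge4$) and $\beta_i=\gamma_i$ for $i\ne3$. Define $s_1=s_2=1$, $t_1=2\beta_2+1$, $t_2=2\beta_2-1$, and for $3\le i\le d-1$, $s_i=\beta_is_{i-1}-s_{i-2}$, $t_i=\beta_it_{i-1}-t_{i-2}$; put $r_i=\tfrac12(kt_i-ns_i)$ for $1\le i\le d-1$. Then $A^G$ is generated as a $\Bbbk$-algebra by $$x_i=\big(u^{ns_i}+(-1)^{r_i+ns_i}v^{ns_i}\big)(uv)^{r_i}\ (1\le i\le d-1),\qquad x_d=(uv)^{2k}.$$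
   Context: $\Bbbk$ is algebraically closed of characteristic $0$; $\Bbbk_{-1}[u,v]=\Bbbk\langle u,v\rangle/(vu+uv)$; matrices $\begin{pmatrix}a&b\\c&d\end{pmatrix}$ act by $u\mapsto au+cv$, $v\mapsto bu+dv$. $G_{n,k}$ is generated by $\mathrm{diag}(\omega^{2k},\omega^{-2k})$ and $\begin{pmatrix}0&\omega^n\\\omega^n&0\end{pmatrix}$ for $\omega$ a primitive $(2nk)$th root of unity. The Hirzebruch–Jung continued fraction of a rational $x>0$ is the unique expression $x=a_1-\cfrac{1}{a_2-\cfrac{1}{\ddots-\cfrac1{a_m}}}=[a_1,\dots,a_m]$ with integers $a_1\ge1$ and $a_2,\dots,a_m\ge2$. *)

theory Defs
  imports "HOL-Computational_Algebra.Polynomial"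
begin

text \<open>An element of k_{-1}[u,v] is represented by its coefficient function on the
  basis monomials u^i v^j, indexed by (i,j). Multiplication is determined by
  u^i v^j * u^l v^m = (-1)^(j*l) u^(i+l) v^(j+m), which is forced by vu = -uv.\<close>

type_synonym 'k skpoly = "nat \<times> nat \<Rightarrow> 'k"

definition skA :: "'k::field skpoly set" where
  "skA = {f. finite {p. f p \<noteq> 0}}"

definition skmul :: "'k::field skpoly \<Rightarrow> 'k skpoly \<Rightarrow> 'k skpoly" where
  "skmul f g = (\<lambda>(a,b). \<Sum>i\<le>a. \<Sum>j\<le>b. (-1)^(j*(a-i)) * f (i,j) * g (a-i, b-j))"

definition skadd :: "'k::field skpoly \<Rightarrow> 'k skpoly \<Rightarrow> 'k skpoly" where
  "skadd f g = (\<lambda>p. f p + g p)"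

definition sksmult :: "'k::field \<Rightarrow> 'k skpoly \<Rightarrow> 'k skpoly" where
  "sksmult c f = (\<lambda>p. c * f p)"

definition skmon :: "nat \<Rightarrow> nat \<Rightarrow> 'k::field skpoly" where
  "skmon i j = (\<lambda>p. if p = (i,j) then 1 else 0)"

definition skone :: "'k::field skpoly" where
  "skone = skmon 0 0"

definition skpow :: "'k::field skpoly \<Rightarrow> nat \<Rightarrow> 'k skpoly" where
  "skpow f m = (skmul f ^^ m) skone"

definition sku :: "'k::field skpoly" where "sku = skmon 1 0"
definition skv :: "'k::field skpoly" where "skv = skmon 0 1"

inductive_set alg_gen :: "'k::field skpoly set \<Rightarrow> 'k skpoly set" for S where
  scal: "sksmult c skone \<in> alg_gen S"
| gen: "s \<in> S \<Longrightarrow> s \<in> alg_gen S"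
| add: "f \<in> alg_gen S \<Longrightarrow> g \<in> alg_gen S \<Longrightarrow> skadd f g \<in> alg_gen S"
| mul: "f \<in> alg_gen S \<Longrightarrow> g \<in> alg_gen S \<Longrightarrow> skmul f g \<in> alg_gen S"

text \<open>A 2x2 matrix ((a,b),(c,d)) is stored as the tuple (a,b,c,d).
  It acts by u |-> a u + c v, v |-> b u + d v, extended multiplicatively and linearly:
  u^i v^j |-> (a u + c v)^i (b u + d v)^j.\<close>

type_synonym 'k mat2 = "'k \<times> 'k \<times> 'k \<times> 'k"

definition mat2_mul :: "'k::field mat2 \<Rightarrow> 'k mat2 \<Rightarrow> 'k mat2" where
  "mat2_mul M N = (case M of (a,b,c,d) \<Rightarrow> case N of (a',b',c',d') \<Rightarrow>
      (a*a' + b*c', a*b' + b*d', c*a' + d*c', c*b' + d*d'))"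

definition mat2_act :: "'k::field mat2 \<Rightarrow> 'k skpoly \<Rightarrow> 'k skpoly" where
  "mat2_act M f = (case M of (a,b,c,d) \<Rightarrow>
     (\<lambda>q. \<Sum>p\<in>{p. f p \<noteq> 0}. f p *
        skmul (skpow (skadd (sksmult a sku) (sksmult c skv)) (fst p))
              (skpow (skadd (sksmult b sku) (sksmult d skv)) (snd p)) q))"

definition Ggen1 :: "'k::field \<Rightarrow> nat \<Rightarrow> nat \<Rightarrow> 'k mat2" where
  "Ggen1 \<omega> n k = (\<omega>^(2*k), 0, 0, inverse (\<omega>^(2*k)))"

definition Ggen2 :: "'k::field \<Rightarrow> nat \<Rightarrow> nat \<Rightarrow> 'k mat2" where
  "Ggen2 \<omega> n k = (0, \<omega>^n, \<omega>^n, 0)"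

text \<open>The group G_{n,k} generated by the two generators (both of finite order,
  so the generated monoid is the generated group).\<close>
inductive_set Gnk :: "'k::field \<Rightarrow> nat \<Rightarrow> nat \<Rightarrow> 'k mat2 set" for \<omega> n k where
  one: "(1,0,0,1) \<in> Gnk \<omega> n k"
| step1: "g \<in> Gnk \<omega> n k \<Longrightarrow> mat2_mul (Ggen1 \<omega> n k) g \<in> Gnk \<omega> n k"
| step2: "g \<in> Gnk \<omega> n k \<Longrightarrow> mat2_mul (Ggen2 \<omega> n k) g \<in> Gnk \<omega> n k"

definition invariant_ring :: "'k::field \<Rightarrow> nat \<Rightarrow> nat \<Rightarrow> 'k skpoly set" where
  "invariant_ring \<omega> n k = {f \<in> skA. \<forall>g \<in> Gnk \<omega> n k. mat2_act g f = f}"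

fun hj_val :: "int list \<Rightarrow> rat" where
  "hj_val [] = 0"
| "hj_val [a] = of_int a"
| "hj_val (a # rest) = of_int a - 1 / hj_val rest"

definition is_HJ :: "int list \<Rightarrow> bool" where
  "is_HJ gs \<longleftrightarrow> gs \<noteq> [] \<and> hd gs \<ge> 1 \<and> (\<forall>g\<in>set (tl gs). g \<ge> 2)"

definition gam :: "int list \<Rightarrow> nat \<Rightarrow> int" where
  "gam gs i = gs ! (i - 1)"

definition bet :: "int list \<Rightarrow> nat \<Rightarrow> int" where
  "bet gs i = (if i = 3 then gam gs i + 1 else gam gs i)"

fun rec2 :: "(nat \<Rightarrow> int) \<Rightarrow> int \<Rightarrow> int \<Rightarrow> nat \<Rightarrow> int" where
  "rec2 \<beta> x1 x2 0 = 0"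
| "rec2 \<beta> x1 x2 (Suc 0) = x1"
| "rec2 \<beta> x1 x2 (Suc (Suc 0)) = x2"
| "rec2 \<beta> x1 x2 (Suc (Suc (Suc m))) =
     \<beta> (m + 3) * rec2 \<beta> x1 x2 (Suc (Suc m)) - rec2 \<beta> x1 x2 (Suc m)"

definition sseq :: "int list \<Rightarrow> nat \<Rightarrow> int" where
  "sseq gs = rec2 (bet gs) 1 1"

definition tseq :: "int list \<Rightarrow> nat \<Rightarrow> int" where
  "tseq gs = rec2 (bet gs) (2 * bet gs 2 + 1) (2 * bet gs 2 - 1)"

definition rseq :: "nat \<Rightarrow> nat \<Rightarrow> int list \<Rightarrow> nat \<Rightarrow> int" where
  "rseq n k gs i = (int k * tseq gs i - int n * sseq gs i) div 2"

definition xgen :: "nat \<Rightarrow> nat \<Rightarrow> int list \<Rightarrow> nat \<Rightarrow> 'k::field skpoly" where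
  "xgen n k gs i =
     skmul (skadd (skpow sku (nat (int n * sseq gs i)))
                  (sksmult (if even (rseq n k gs i + int n * sseq gs i) then 1 else -1)
                           (skpow skv (nat (int n * sseq gs i)))))
           (skpow (skmul sku skv) (nat (rseq n k gs i)))"

end

theory Submission
  imports Defs
begin

text \<open>Write \<open>\<eta> = \<omega>^n\<close>. Invariance of \<open>f\<close> means that \<open>u^i v^j\<close> only occurs if \<open>n\<close> divides
  \<open>i - j\<close>, and that exchanging \<open>i\<close> and \<open>j\<close> multiplies coefficients by \<open>(-1)^(i j) \<eta>^(i + j)\<close>.
  Hence the exponents satisfy \<open>i - j = n s\<close> and \<open>i + j = k t\<close> with \<open>s \<equiv> t\<close> modulo 2, and
  4 divides \<open>t\<close> if \<open>s = 0\<close>. Taking the monomial with the largest \<open>i - j\<close> as leading term,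
  leading terms are multiplicative up to sign, so it suffices that the pairs \<open>(s, t)\<close> with
  \<open>s \<ge> 0\<close> and \<open>k t \<ge> n s\<close> are generated by \<open>(0, 4)\<close> and the \<open>(s\<^sub>i, t\<^sub>i)\<close>. Without the
  condition at \<open>s = 0\<close> this would be the semigroup of lattice points in a cone, whose
  generators \<open>(0, 2), (s\<^sub>2, t\<^sub>2), (s\<^sub>3, t\<^sub>3), \<dots>\<close> come from the continued fraction of
  \<open>(n + k) / (2k)\<close>; replacing \<open>(0, 2)\<close> by \<open>(0, 4)\<close> costs the extra generator
  \<open>(s\<^sub>1, t\<^sub>1) = (0, 2) + (s\<^sub>2, t\<^sub>2)\<close>.\<close>

section \<open>Monomials and products in the skew polynomial ring\<close>

lemma skmul_skmon_left:
  "skmul (skmon i j) g (a, b) =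
     (if i \<le> a \<and> j \<le> b then (-1)^(j*(a-i)) * g (a-i, b-j) else (0::'k::field))"
proof -
  have "skmul (skmon i j) g (a, b) =
     (\<Sum>i'\<le>a. \<Sum>j'\<le>b. if j' = j then (if i' = i then (-1)^(j*(a-i)) * g (a-i, b-j) else 0) else 0)"
    unfolding skmul_def skmon_def prod.case by (intro sum.cong refl) auto
  also have "\<dots> = (if i \<le> a \<and> j \<le> b then (-1)^(j*(a-i)) * g (a-i, b-j) else 0)"
    by (cases "j \<le> b") (simp_all add: sum.delta)
  finally show ?thesis .
qed

lemma skmul_skmon_skmon:
  "skmul (skmon i j) (skmon l m) = sksmult ((-1)^(j*l)) (skmon (i+l) (j+m) :: 'k::field skpoly)"
proof
  fix p :: "nat \<times> nat"
  obtain a b where p: "p = (a, b)" by (cases p)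
  show "skmul (skmon i j) (skmon l m) p = sksmult ((-1)^(j*l)) (skmon (i+l) (j+m) :: 'k skpoly) p"
    unfolding p skmul_skmon_left by (auto simp: skmon_def sksmult_def)
qed

lemma skmul_skone_left: "skmul skone g = g"
  by (rule ext) (auto simp: skone_def skmul_skmon_left)

lemma skmul_sksmult_left: "skmul (sksmult c f) g = sksmult c (skmul f g)"
  by (auto simp: skmul_def sksmult_def fun_eq_iff sum_distrib_left algebra_simps)

lemma skmul_sksmult_right: "skmul f (sksmult c g) = sksmult c (skmul f g)"
  by (auto simp: skmul_def sksmult_def fun_eq_iff sum_distrib_left algebra_simps)

lemma skmul_skadd_left: "skmul (skadd f h) g = skadd (skmul f g) (skmul h g)"
  by (auto simp: skmul_def skadd_def fun_eq_iff algebra_simps sum.distrib)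

lemma sksmult_sksmult: "sksmult a (sksmult b f) = sksmult (a * b) f"
  by (simp add: sksmult_def mult.assoc)

lemma skpow_0: "skpow f 0 = skone"
  by (simp add: skpow_def)

lemma skpow_Suc: "skpow f (Suc m) = skmul f (skpow f m)"
  by (simp add: skpow_def)

lemma skpow_smult_sku: "skpow (sksmult a sku) i = sksmult (a ^ i) (skmon i 0)"
proof (induction i)
  case 0 show ?case by (simp add: skpow_0 skone_def sksmult_def)
next
  case (Suc i) then show ?case
    by (simp add: skpow_Suc sku_def skmul_sksmult_left skmul_sksmult_right skmul_skmon_skmon
        sksmult_sksmult mult.commute)
qed

lemma skpow_smult_skv: "skpow (sksmult a skv) i = sksmult (a ^ i) (skmon 0 i)"
proof (induction i)
  case 0 show ?case by (simp add: skpow_0 skone_def sksmult_def)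
next
  case (Suc i) then show ?case
    by (simp add: skpow_Suc skv_def skmul_sksmult_left skmul_sksmult_right skmul_skmon_skmon
        sksmult_sksmult mult.commute)
qed

lemma sksmult_1: "sksmult 1 f = f"
  by (simp add: sksmult_def)

lemma skpow_sku: "skpow sku i = skmon i 0"
  using skpow_smult_sku[of 1 i] by (simp add: sksmult_1)

lemma skpow_skv: "skpow skv i = skmon 0 i"
  using skpow_smult_skv[of 1 i] by (simp add: sksmult_1)

text \<open>The scalar is a product of signs from moving \<open>v\<close> past \<open>u\<close>. It
  can stay unspecified because a nonzero factor changes neither membership in an algebra nor leading
  monomials.\<close>

lemma skpow_uv:
  "\<exists>c. c \<noteq> 0 \<and> skpow (skmul sku skv) r = sksmult c (skmon r r :: 'k::field skpoly)"
proof (induction r)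
  case 0 show ?case by (rule exI[of _ 1]) (simp add: skpow_0 skone_def sksmult_1)
next
  case (Suc r)
  then obtain c :: 'k where c: "c \<noteq> 0" "skpow (skmul sku skv) r = sksmult c (skmon r r)" by blast
  have uv: "skmul sku skv = (skmon 1 1 :: 'k skpoly)"
    by (simp add: sku_def skv_def skmul_skmon_skmon sksmult_1)
  show ?case
    using c by (intro exI[of _ "c * (-1)^r"])
      (simp add: skpow_Suc uv skmul_sksmult_right skmul_skmon_skmon sksmult_sksmult)
qed

lemma skmul_nonzeroD:
  assumes "skmul f g (a, b) \<noteq> 0"
  obtains i j where "i \<le> a" "j \<le> b" "f (i, j) \<noteq> 0" "g (a - i, b - j) \<noteq> 0"
proof -
  from assms obtain i where i: "i \<le> a"
    "(\<Sum>j\<le>b. (-1)^(j*(a-i)) * f (i,j) * g (a-i, b-j)) \<noteq> 0"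
    unfolding skmul_def by (auto elim: sum.not_neutral_contains_not_neutral)
  from i(2) obtain j where "j \<le> b" "(-1)^(j*(a-i)) * f (i,j) * g (a-i, b-j) \<noteq> 0"
    by (auto elim: sum.not_neutral_contains_not_neutral)
  with i that show ?thesis by auto
qed

lemma skA_skmul:
  assumes "f \<in> skA" "g \<in> skA"
  shows "skmul f g \<in> skA"
proof -
  let ?h = "\<lambda>((i, j), (l, m)). (i + l, j + m)"
  have "{p. skmul f g p \<noteq> 0} \<subseteq> ?h ` ({p. f p \<noteq> 0} \<times> {p. g p \<noteq> 0})"
  proof
    fix p assume "p \<in> {p. skmul f g p \<noteq> 0}"
    then obtain a b where p: "p = (a, b)" "skmul f g (a, b) \<noteq> 0" by (cases p) auto
    from p(2) obtain i j where "i \<le> a" "j \<le> b" "f (i, j) \<noteq> 0" "g (a - i, b - j) \<noteq> 0"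
      by (rule skmul_nonzeroD)
    then show "p \<in> ?h ` ({p. f p \<noteq> 0} \<times> {p. g p \<noteq> 0})"
      unfolding p by (intro image_eqI[of _ _ "((i, j), (a - i, b - j))"]) auto
  qed
  moreover have "finite (?h ` ({p. f p \<noteq> 0} \<times> {p. g p \<noteq> 0}))"
    using assms by (auto simp: skA_def)
  ultimately show ?thesis unfolding skA_def by (auto intro: finite_subset)
qed

section \<open>Leading terms with respect to the difference of exponents\<close>

definition diff2 :: "nat \<times> nat \<Rightarrow> int" where
  "diff2 p = int (fst p) - int (snd p)"

text \<open>Since \<open>(i, j)\<close> and \<open>(i + 1, j + 1)\<close> tie under
  \<open>diff2\<close>, this is not a monomial order and many polynomials have no leading monomial.
  Strictness makes the leading monomial unique when it exists.\<close>

definition leads :: "'k::field skpoly \<Rightarrow> nat \<times> nat \<Rightarrow> bool" where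
  "leads f p \<longleftrightarrow> f p \<noteq> 0 \<and> (\<forall>q. f q \<noteq> 0 \<longrightarrow> q = p \<or> diff2 q < diff2 p)"

text \<open>Differences of exponents add under multiplication, so the top difference is reached only
  by the product of the two leading monomials and nothing can cancel it.\<close>

lemma leads_skmul:
  assumes f: "leads f (i, j)" and g: "leads g (l, m)"
  shows "leads (skmul f g) (i + l, j + m)"
proof -
  let ?t = "\<lambda>x. (-1)^(snd x*(i+l-fst x)) * f x * g (i+l-fst x, j+m-snd x)"
  have "skmul f g (i+l, j+m) = (\<Sum>x\<in>{..i+l}\<times>{..j+m}. ?t x)"
    by (simp add: skmul_def sum.cartesian_product case_prod_beta)
  also have "\<dots> = (\<Sum>x\<in>{(i, j)}. ?t x)"
  proof (rule sum.mono_neutral_right)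
    show "\<forall>x\<in>{..i+l}\<times>{..j+m} - {(i, j)}. ?t x = 0"
    proof (rule ballI, rule ccontr)
      fix x assume x: "x \<in> {..i+l}\<times>{..j+m} - {(i, j)}" and "?t x \<noteq> 0"
      then have "f x \<noteq> 0" "g (i+l-fst x, j+m-snd x) \<noteq> 0" by auto
      with x f g have "diff2 x < diff2 (i, j)" "diff2 (i+l-fst x, j+m-snd x) \<le> diff2 (l, m)"
        unfolding leads_def by force+
      with x show False by (auto simp: diff2_def of_nat_diff)
    qed
  qed auto
  also have "\<dots> \<noteq> 0" using f g by (simp add: leads_def)
  finally have nz: "skmul f g (i+l, j+m) \<noteq> 0" .
  moreover have "q = (i+l, j+m) \<or> diff2 q < diff2 (i+l, j+m)" if "skmul f g q \<noteq> 0" for q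
  proof -
    obtain a b where q: "q = (a, b)" by (cases q)
    from that[unfolded q] obtain c d where
      cd: "c \<le> a" "d \<le> b" "f (c, d) \<noteq> 0" "g (a - c, b - d) \<noteq> 0"
      by (rule skmul_nonzeroD)
    with f g have "(c, d) = (i, j) \<or> diff2 (c, d) < diff2 (i, j)"
      "(a - c, b - d) = (l, m) \<or> diff2 (a - c, b - d) < diff2 (l, m)"
      unfolding leads_def by blast+
    with cd(1,2) show ?thesis by (auto simp: q diff2_def of_nat_diff)
  qed
  ultimately show ?thesis unfolding leads_def by blast
qed

section \<open>Generated subalgebras, symmetric elements and reduction by leading terms\<close>

lemma alg_gen_sksmult: "f \<in> alg_gen S \<Longrightarrow> sksmult c f \<in> alg_gen S"
  using alg_gen.mul[OF alg_gen.scal, of f S c] by (simp add: skmul_sksmult_left skmul_skone_left)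

lemma alg_gen_zero: "(\<lambda>_. 0) \<in> alg_gen S"
  using alg_gen.scal[of 0 S] by (simp add: sksmult_def)

lemma alg_gen_sum:
  assumes "finite B" "\<And>p. p \<in> B \<Longrightarrow> F p \<in> alg_gen S"
  shows "(\<lambda>q. \<Sum>p\<in>B. F p q) \<in> alg_gen S"
  using assms
proof (induction B rule: finite_induct)
  case empty show ?case by (simp add: alg_gen_zero)
next
  case (insert x B)
  then have "skadd (F x) (\<lambda>q. \<Sum>p\<in>B. F p q) \<in> alg_gen S" by (intro alg_gen.add) auto
  with insert show ?case by (simp add: skadd_def)
qed

text \<open>A coefficientwise form of invariance. The divisibility condition stands for
  \<open>Ggen1\<close>, whose power of \<omega> has order \<open>n\<close>; the exchange rule stands
  for \<open>Ggen2\<close> with \<open>\<eta> = \<omega>^n\<close>.\<close>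

definition swap_sym :: "nat \<Rightarrow> 'k::field \<Rightarrow> 'k skpoly set" where
  "swap_sym n \<eta> = {f \<in> skA. (\<forall>i j. f (i, j) \<noteq> 0 \<longrightarrow> int n dvd int i - int j) \<and>
     (\<forall>i j. f (j, i) = (-1)^(i*j) * \<eta>^(i+j) * f (i, j))}"

lemma skA_skadd: "f \<in> skA \<Longrightarrow> g \<in> skA \<Longrightarrow> skadd f g \<in> skA"
  unfolding skA_def skadd_def
  by (auto intro: finite_subset[of _ "{p. f p \<noteq> 0} \<union> {p. g p \<noteq> 0}"])

lemma skA_sksmult: "f \<in> skA \<Longrightarrow> sksmult c f \<in> skA"
  unfolding skA_def sksmult_def by (auto intro: finite_subset[of _ "{p. f p \<noteq> 0}"])

lemma skA_skmon: "skmon i j \<in> skA"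
  unfolding skA_def skmon_def by (auto intro: finite_subset[of _ "{(i, j)}"])

lemma swap_sym_skadd:
  assumes "f \<in> swap_sym n \<eta>" "g \<in> swap_sym n \<eta>"
  shows "skadd f g \<in> swap_sym n \<eta>"
proof -
  have "skadd f g (j, i) = (-1)^(i*j) * \<eta>^(i+j) * skadd f g (i, j)" for i j
  proof -
    have "f (j, i) = (-1)^(i*j) * \<eta>^(i+j) * f (i, j)" "g (j, i) = (-1)^(i*j) * \<eta>^(i+j) * g (i, j)"
      using assms unfolding swap_sym_def by blast+
    then show ?thesis by (simp add: skadd_def distrib_left)
  qed
  moreover have "int n dvd int i - int j" if "skadd f g (i, j) \<noteq> 0" for i j
  proof -
    from that have "f (i, j) \<noteq> 0 \<or> g (i, j) \<noteq> 0" by (auto simp: skadd_def)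
    with assms show ?thesis unfolding swap_sym_def by blast
  qed
  ultimately show ?thesis using assms skA_skadd unfolding swap_sym_def by blast
qed

lemma swap_sym_sksmult:
  assumes "f \<in> swap_sym n \<eta>"
  shows "sksmult c f \<in> swap_sym n \<eta>"
proof -
  have "sksmult c f (j, i) = (-1)^(i*j) * \<eta>^(i+j) * sksmult c f (i, j)" for i j
  proof -
    have "f (j, i) = (-1)^(i*j) * \<eta>^(i+j) * f (i, j)"
      using assms unfolding swap_sym_def by blast
    then show ?thesis by (simp add: sksmult_def)
  qed
  moreover have "int n dvd int i - int j" if "sksmult c f (i, j) \<noteq> 0" for i j
  proof -
    from that have "f (i, j) \<noteq> 0" by (auto simp: sksmult_def)
    with assms show ?thesis unfolding swap_sym_def by blast
  qed
  ultimately show ?thesis using assms skA_sksmult unfolding swap_sym_def by blast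
qed

lemma swap_sym_skone: "skone \<in> swap_sym n \<eta>"
  using skA_skmon by (auto simp: swap_sym_def skone_def skmon_def)

text \<open>The map \<open>u \<mapsto> \<eta> v\<close>, \<open>v \<mapsto> \<eta> u\<close> is
  compatible with \<open>vu = -uv\<close>, so its fixed elements are closed under products. The
  proof checks this on coefficients, exchanging the two summations.\<close>

lemma swap_sym_skmul:
  assumes f: "f \<in> swap_sym n \<eta>" and g: "g \<in> swap_sym n \<eta>"
  shows "skmul f g \<in> swap_sym n \<eta>"
proof -
  have "skmul f g (b, a) = (-1)^(a*b) * \<eta>^(a+b) * skmul f g (a, b)" for a b
  proof -
    have "skmul f g (b, a) = (\<Sum>i\<le>a. \<Sum>j\<le>b. (-1)^(i*(b-j)) * f (j, i) * g (b-j, a-i))"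
      unfolding skmul_def by (simp add: sum.swap[of _ "{..b}"])
    also have "\<dots> = (\<Sum>i\<le>a. \<Sum>j\<le>b. (-1)^(a*b) * \<eta>^(a+b) *
        ((-1)^(j*(a-i)) * f (i, j) * g (a-i, b-j)))"
    proof (intro sum.cong refl)
      fix i j assume "i \<in> {..a}" "j \<in> {..b}"
      then obtain i' j' where ij: "a = i + i'" "b = j + j'" by (auto simp: le_iff_add)
      have s: "f (j, i) = (-1)^(i*j) * \<eta>^(i+j) * f (i, j)"
        "g (j', i') = (-1)^(i'*j') * \<eta>^(i'+j') * g (i', j')"
        using f g unfolding swap_sym_def by blast+
      \<comment> \<open>Modulo 2 both exponents are \<open>i*j + i*j' + i'*j'\<close>; on the right
        the term \<open>i'*j\<close> occurs twice.\<close>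
      have "(-1::'a)^(i*j') * ((-1)^(i*j) * (-1)^(i'*j')) = (-1)^((i+i')*(j+j')) * (-1)^(j*i')"
        by (cases "even i"; cases "even j"; cases "even i'"; cases "even j'")
          (simp_all flip: power_add)
      then show "(-1)^(i*(b-j)) * f (j, i) * g (b-j, a-i) =
         (-1)^(a*b) * \<eta>^(a+b) * ((-1)^(j*(a-i)) * f (i, j) * g (a-i, b-j))"
        unfolding ij add_diff_cancel_left' s by (simp add: power_add algebra_simps)
    qed
    finally show ?thesis by (simp add: skmul_def sum_distrib_left)
  qed
  moreover have "int n dvd int a - int b" if "skmul f g (a, b) \<noteq> 0" for a b
  proof -
    from that obtain i j where
      ij: "i \<le> a" "j \<le> b" "f (i, j) \<noteq> 0" "g (a - i, b - j) \<noteq> 0"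
      by (rule skmul_nonzeroD)
    with f g have "int n dvd int i - int j" "int n dvd int (a - i) - int (b - j)"
      unfolding swap_sym_def by blast+
    then have "int n dvd (int i - int j) + (int (a - i) - int (b - j))" by (rule dvd_add)
    with ij show ?thesis by (simp add: of_nat_diff)
  qed
  ultimately show ?thesis using f g skA_skmul unfolding swap_sym_def by blast
qed

lemma alg_gen_subset_swap_sym:
  assumes "S \<subseteq> swap_sym n \<eta>"
  shows "alg_gen S \<subseteq> swap_sym n \<eta>"
proof
  fix f assume "f \<in> alg_gen S"
  then show "f \<in> swap_sym n \<eta>"
    by induction (use assms in \<open>auto intro: swap_sym_skadd swap_sym_skmul swap_sym_sksmult swap_sym_skone\<close>)
qed

text \<open>Subtracting a combination of the given elements strictly lowers the maximal
  value of \<open>i - j\<close> on the support, and by symmetry the minimal value rises.\<close>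
lemma swap_sym_subset_alg_gen:
  assumes S: "S \<subseteq> swap_sym n \<eta>"
    and lead: "\<And>f i j. f \<in> swap_sym n \<eta> \<Longrightarrow> f (i, j) \<noteq> 0 \<Longrightarrow> j \<le> i \<Longrightarrow>
        \<exists>m\<in>alg_gen S. leads m (i, j)"
  shows "swap_sym n \<eta> \<subseteq> alg_gen S"
proof -
  have sym: "f (j, i) \<noteq> 0" if "f \<in> swap_sym n \<eta>" "f (i, j) \<noteq> 0" for f i j
  proof
    assume "f (j, i) = 0"
    moreover have "f (i, j) = (-1)^(j*i) * \<eta>^(j+i) * f (j, i)"
      using that(1) unfolding swap_sym_def by blast
    ultimately show False using that(2) by simp
  qed
  have main: "f \<in> swap_sym n \<eta> \<Longrightarrow> (\<And>q. f q \<noteq> 0 \<Longrightarrow> diff2 q < int D) \<Longrightarrow> f \<in> alg_gen S" for f D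
  proof (induction D arbitrary: f)
    case 0
    \<comment> \<open>All differences on the support are negative, but the support is symmetric
      under exchange, so it is empty.\<close>
    have "f (i, j) = 0" for i j
    proof (rule ccontr)
      assume "f (i, j) \<noteq> 0"
      with sym[OF 0(1), of i j] 0(2)[of "(i, j)"] 0(2)[of "(j, i)"] show False
        by (auto simp: diff2_def)
    qed
    then have "f = (\<lambda>_. 0)" by auto
    then show ?case by (simp add: alg_gen_zero)
  next
    case (Suc D)
    \<comment> \<open>Several monomials can share the top difference \<open>D\<close>; the whole
      layer is removed at once.\<close>
    define B where "B = {p. f p \<noteq> 0 \<and> diff2 p = int D}"
    have finB: "finite B"
      using Suc.prems(1) unfolding B_def swap_sym_def skA_def
      by (auto elim: finite_subset[rotated])
    have "\<exists>m\<in>alg_gen S. leads m p" if "p \<in> B" for p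
      using that lead[OF Suc.prems(1), of "fst p" "snd p"] by (auto simp: B_def diff2_def)
    then obtain m where m: "\<And>p. p \<in> B \<Longrightarrow> m p \<in> alg_gen S" "\<And>p. p \<in> B \<Longrightarrow> leads (m p) p"
      by metis
    define h where "h = (\<lambda>q. \<Sum>p\<in>B. sksmult (f p / m p p) (m p) q)"
    have h: "h \<in> alg_gen S"
      unfolding h_def using finB m(1) by (intro alg_gen_sum alg_gen_sksmult) auto
    define f' where "f' = skadd f (sksmult (-1) h)"
    have f'sym: "f' \<in> swap_sym n \<eta>"
      unfolding f'_def using alg_gen_subset_swap_sym[OF S] h Suc.prems(1)
      by (intro swap_sym_skadd swap_sym_sksmult) auto
    have "diff2 q < int D" if q: "f' q \<noteq> 0" for q
    proof (rule ccontr)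
      assume nlt: "\<not> diff2 q < int D"
      \<comment> \<open>Away from its leading monomial, \<open>m p\<close> lives strictly below
        difference \<open>D\<close>, so the elements chosen for a layer do not interfere with each
        other on it.\<close>
      have nz: "m p q = 0" if "p \<in> B" "p \<noteq> q" for p
        using m(2)[OF that(1)] that nlt unfolding leads_def B_def by fastforce
      show False
      proof (cases "q \<in> B")
        case True
        have "h q = (\<Sum>p\<in>B. if p = q then f q else 0)"
          unfolding h_def
        proof (rule sum.cong)
          fix p assume "p \<in> B"
          with nz[of p] m(2)[of p]
          show "sksmult (f p / m p p) (m p) q = (if p = q then f q else 0)"
            by (auto simp: sksmult_def leads_def)
        qed simp
        with True finB q show False by (simp add: f'_def skadd_def sksmult_def)
      next
        case False
        then have "m p q = 0" if "p \<in> B" for p using nz that by blast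
        then have "h q = 0" unfolding h_def by (intro sum.neutral) (auto simp: sksmult_def)
        with q have "f q \<noteq> 0" by (simp add: f'_def skadd_def sksmult_def)
        with Suc.prems(2)[of q] nlt False show False by (auto simp: B_def)
      qed
    qed
    with f'sym have "f' \<in> alg_gen S" by (rule Suc.IH)
    with h have "skadd f' h \<in> alg_gen S" by (intro alg_gen.add)
    then show ?case by (simp add: f'_def skadd_def sksmult_def)
  qed
  show ?thesis
  proof
    fix f assume f: "f \<in> swap_sym n \<eta>"
    then have fin: "finite {p. f p \<noteq> 0}" by (simp add: swap_sym_def skA_def)
    \<comment> \<open>A crude strict bound: the difference at a monomial is at most its first
      exponent.\<close>
    define D where "D = Suc (\<Sum>p\<in>{p. f p \<noteq> 0}. fst p)"
    have "diff2 q < int D" if "f q \<noteq> 0" for q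
    proof -
      have "fst q \<le> (\<Sum>p\<in>{p. f p \<noteq> 0}. fst p)" using fin that by (intro member_le_sum) auto
      then have "fst q < D" by (simp add: D_def)
      then show ?thesis by (simp add: diff2_def)
    qed
    with f show "f \<in> alg_gen S" by (rule main)
  qed
qed

section \<open>The group action and its invariants\<close>

lemma skadd_zero_right: "skadd f (sksmult 0 g) = f"
  by (simp add: skadd_def sksmult_def)

lemma skadd_zero_left: "skadd (sksmult 0 g) f = f"
  by (simp add: skadd_def sksmult_def)

lemma mat2_act_diag:
  assumes "f \<in> skA"
  shows "mat2_act (a, 0, 0, d) f (i, j) = a^i * d^j * f (i, j)"
proof -
  have "mat2_act (a, 0, 0, d) f (i, j) =
    (\<Sum>p\<in>{p. f p \<noteq> 0}. if p = (i, j) then a^i * d^j * f (i, j) else 0)"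
    unfolding mat2_act_def prod.case skadd_zero_left skadd_zero_right skpow_smult_sku
      skpow_smult_skv skmul_sksmult_left skmul_sksmult_right skmul_skmon_skmon
    by (intro sum.cong refl) (auto simp: sksmult_def skmon_def)
  then show ?thesis using assms by (simp add: skA_def)
qed

lemma mat2_act_antidiag:
  assumes "f \<in> skA"
  shows "mat2_act (0, b, c, 0) f (j, i) = (-1)^(i*j) * c^i * b^j * f (i, j)"
proof -
  have "mat2_act (0, b, c, 0) f (j, i) =
    (\<Sum>p\<in>{p. f p \<noteq> 0}. if p = (i, j) then (-1)^(i*j) * c^i * b^j * f (i, j) else 0)"
    unfolding mat2_act_def prod.case skadd_zero_left skadd_zero_right skpow_smult_sku
      skpow_smult_skv skmul_sksmult_left skmul_sksmult_right skmul_skmon_skmon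
    by (intro sum.cong refl) (auto simp: sksmult_def skmon_def)
  then show ?thesis using assms by (simp add: skA_def)
qed

text \<open>Every group element is diagonal or antidiagonal, and its entries matter only through the
  powers taken on the support of \<open>f\<close>. Carrying these powers through the induction
  avoids proving that \<open>mat2_act\<close> respects matrix products.\<close>

lemma Gnk_action:
  fixes \<omega> :: "'k::field"
  assumes f: "f \<in> swap_sym n (\<omega>^n)"
    and prim: "\<And>i j. int n dvd int i - int j \<Longrightarrow> (\<omega>^(2*k))^i * inverse (\<omega>^(2*k))^j = 1"
    and g: "g \<in> Gnk \<omega> n k"
  shows "(\<exists>a d. g = (a, 0, 0, d) \<and> (\<forall>i j. f (i, j) \<noteq> 0 \<longrightarrow> a^i * d^j = 1)) \<or>
         (\<exists>b c. g = (0, b, c, 0) \<and> (\<forall>i j. f (j, i) = (-1)^(i*j) * c^i * b^j * f (i, j)))"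
  using g
proof induction
  case one
  then show ?case by simp
next
  case (step1 g)
  define z where "z = \<omega>^(2*k)"
  have z: "z^i * inverse z^j = 1" if "f (i, j) \<noteq> 0" for i j
    using f that prim[of i j] unfolding z_def swap_sym_def by blast
  have z': "z^j * inverse z^i = 1" if "f (i, j) \<noteq> 0" for i j
    using f that prim[of j i] unfolding z_def swap_sym_def by (metis (mono_tags, lifting) dvd_diff_commute mem_Collect_eq)
  from step1.IH show ?case
  proof (elim disjE exE conjE)
    fix a d assume g: "g = (a, 0, 0, d)" and f1: "\<forall>i j. f (i, j) \<noteq> 0 \<longrightarrow> a^i * d^j = 1"
    have "(z*a)^i * (inverse z*d)^j = 1" if "f (i, j) \<noteq> 0" for i j
    proof -
      have "(z*a)^i * (inverse z*d)^j = (z^i * inverse z^j) * (a^i * d^j)"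
        by (simp only: power_mult_distrib mult_ac)
      with f1 z that show ?thesis by simp
    qed
    moreover have "mat2_mul (Ggen1 \<omega> n k) g = (z*a, 0, 0, inverse z*d)"
      by (simp add: g mat2_mul_def Ggen1_def flip: z_def)
    ultimately show ?thesis by blast
  next
    fix b c assume g: "g = (0, b, c, 0)"
      and f2: "\<forall>i j. f (j, i) = (-1)^(i*j) * c^i * b^j * f (i, j)"
    have "f (j, i) = (-1)^(i*j) * (inverse z*c)^i * (z*b)^j * f (i, j)" for i j
    proof (cases "f (i, j) = 0")
      case True
      moreover have "f (j, i) = (-1)^(i*j) * c^i * b^j * f (i, j)" using f2 by blast
      ultimately show ?thesis by simp
    next
      case False
      have "(-1)^(i*j) * (inverse z*c)^i * (z*b)^j * f (i, j) =
        (z^j * inverse z^i) * ((-1)^(i*j) * c^i * b^j * f (i, j))"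
        by (simp only: power_mult_distrib mult_ac)
      also have "\<dots> = (-1)^(i*j) * c^i * b^j * f (i, j)" unfolding z'[OF False] by simp
      also have "\<dots> = f (j, i)" using f2 by metis
      finally show ?thesis by (rule sym)
    qed
    moreover have "mat2_mul (Ggen1 \<omega> n k) g = (0, z*b, inverse z*c, 0)"
      by (simp add: g mat2_mul_def Ggen1_def flip: z_def)
    ultimately show ?thesis by blast
  qed
next
  case (step2 g)
  define e where "e = \<omega>^n"
  have e: "f (j, i) = (-1)^(i*j) * e^(i+j) * f (i, j)" for i j
    using f unfolding e_def swap_sym_def by blast
  from step2.IH show ?case
  proof (elim disjE exE conjE)
    fix a d assume g: "g = (a, 0, 0, d)" and f1: "\<forall>i j. f (i, j) \<noteq> 0 \<longrightarrow> a^i * d^j = 1"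
    have "f (j, i) = (-1)^(i*j) * (e*a)^i * (e*d)^j * f (i, j)" for i j
    proof (cases "f (i, j) = 0")
      case True
      moreover have "f (j, i) = (-1)^(i*j) * e^(i+j) * f (i, j)" by (rule e)
      ultimately show ?thesis by simp
    next
      case False
      have "(-1)^(i*j) * (e*a)^i * (e*d)^j * f (i, j) =
        (a^i * d^j) * ((-1)^(i*j) * e^(i+j) * f (i, j))"
        by (simp only: power_mult_distrib power_add mult_ac)
      also have "a^i * d^j = 1" using f1 False by simp
      finally show ?thesis unfolding e[of j i] mult_1_left by (rule sym)
    qed
    moreover have "mat2_mul (Ggen2 \<omega> n k) g = (0, e*d, e*a, 0)"
      by (simp add: g mat2_mul_def Ggen2_def flip: e_def)
    ultimately show ?thesis by blast
  next
    fix b c assume g: "g = (0, b, c, 0)"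
      and f2: "\<forall>i j. f (j, i) = (-1)^(i*j) * c^i * b^j * f (i, j)"
    \<comment> \<open>Exchanging once by the rule for \<open>e\<close> and once by that for
      \<open>b\<close> and \<open>c\<close> returns to the same coefficient; the signs square to 1,
      so the remaining scalar is 1.\<close>
    have "(e*c)^i * (e*b)^j = 1" if "f (i, j) \<noteq> 0" for i j
    proof -
      have "f (i, j) = (-1)^(j*i) * e^(j+i) * f (j, i)" by (rule e)
      also have "f (j, i) = (-1)^(i*j) * c^i * b^j * f (i, j)" using f2 by blast
      also have "(-1)^(j*i) * e^(j+i) * ((-1)^(i*j) * c^i * b^j * f (i, j)) =
         ((-1)^(i*j) * (-1)^(i*j)) * ((e*c)^i * (e*b)^j) * f (i, j)"
        by (simp only: power_mult_distrib power_add mult_ac)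
      also have "(-1::'k)^(i*j) * (-1)^(i*j) = 1" by (simp flip: power_mult_distrib)
      finally show ?thesis using that by simp
    qed
    moreover have "mat2_mul (Ggen2 \<omega> n k) g = (e*c, 0, 0, e*b)"
      by (simp add: g mat2_mul_def Ggen2_def flip: e_def)
    ultimately show ?thesis by blast
  qed
qed

lemma power_mult_inverse_power_eq_1_iff:
  fixes z :: "'k::field"
  assumes z: "\<And>m. z^m = 1 \<longleftrightarrow> n dvd m" and nz: "z \<noteq> 0"
  shows "z^i * inverse z^j = 1 \<longleftrightarrow> int n dvd int i - int j"
proof -
  have "z^i * inverse z^j = 1 \<longleftrightarrow> z^i = z^j" using nz by (simp add: power_inverse field_simps)
  also have "\<dots> \<longleftrightarrow> int n dvd int i - int j"
  proof (cases "j \<le> i")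
    case True
    then obtain m where m: "i = j + m" by (auto simp: le_iff_add)
    with nz z[of m] show ?thesis by (simp add: power_add)
  next
    case False
    then obtain m where m: "j = i + m" by (metis le_iff_add nat_le_linear)
    with nz z[of m] show ?thesis by (simp add: power_add)
  qed
  finally show ?thesis .
qed

lemma invariant_ring_eq_swap_sym:
  fixes \<omega> :: "'k::field"
  assumes nz: "\<omega> \<noteq> 0" and prim: "\<And>m. (\<omega>^(2*k))^m = 1 \<longleftrightarrow> n dvd m"
  shows "invariant_ring \<omega> n k = swap_sym n (\<omega>^n)"
proof
  have *: "(\<omega>^(2*k))^i * inverse (\<omega>^(2*k))^j = 1 \<longleftrightarrow> int n dvd int i - int j" for i j
    using power_mult_inverse_power_eq_1_iff[OF prim] nz by simp
  show "swap_sym n (\<omega>^n) \<subseteq> invariant_ring \<omega> n k"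
  proof
    fix f assume f: "f \<in> swap_sym n (\<omega>^n)"
    then have fA: "f \<in> skA" by (simp add: swap_sym_def)
    have "mat2_act g f = f" if g: "g \<in> Gnk \<omega> n k" for g
    proof
      fix q :: "nat \<times> nat"
      obtain i j where q: "q = (i, j)" by (cases q)
      have "(\<exists>a d. g = (a, 0, 0, d) \<and> (\<forall>i j. f (i, j) \<noteq> 0 \<longrightarrow> a^i * d^j = 1)) \<or>
         (\<exists>b c. g = (0, b, c, 0) \<and> (\<forall>i j. f (j, i) = (-1)^(i*j) * c^i * b^j * f (i, j)))"
        using f _ g by (rule Gnk_action) (simp add: *)
      then show "mat2_act g f q = f q"
      proof (elim disjE exE conjE)
        fix a d assume "g = (a, 0, 0, d)" "\<forall>i j. f (i, j) \<noteq> 0 \<longrightarrow> a^i * d^j = 1"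
        then show ?thesis using mat2_act_diag[OF fA, of a d i j] by (cases "f q = 0") (auto simp: q)
      next
        fix b c assume "g = (0, b, c, 0)" "\<forall>i j. f (j, i) = (-1)^(i*j) * c^i * b^j * f (i, j)"
        then show ?thesis using mat2_act_antidiag[OF fA, of b c i j] by (metis q)
      qed
    qed
    with fA show "f \<in> invariant_ring \<omega> n k" by (simp add: invariant_ring_def)
  qed
  show "invariant_ring \<omega> n k \<subseteq> swap_sym n (\<omega>^n)"
  proof
    fix f assume f: "f \<in> invariant_ring \<omega> n k"
    then have fA: "f \<in> skA" by (simp add: invariant_ring_def)
    have one: "mat2_mul M (1, 0, 0, 1) = M" for M :: "'k mat2"
      by (cases M) (simp add: mat2_mul_def)
    \<comment> \<open>For this inclusion the two generators suffice: each yields one of the two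
      coefficient conditions.\<close>
    have "Ggen1 \<omega> n k \<in> Gnk \<omega> n k" "Ggen2 \<omega> n k \<in> Gnk \<omega> n k"
      using Gnk.step1[OF Gnk.one, of \<omega> n k] Gnk.step2[OF Gnk.one, of \<omega> n k] by (simp_all add: one)
    with f have g: "mat2_act (Ggen1 \<omega> n k) f = f" "mat2_act (Ggen2 \<omega> n k) f = f"
      by (auto simp: invariant_ring_def)
    have "int n dvd int i - int j" if "f (i, j) \<noteq> 0" for i j
      using mat2_act_diag[OF fA, of "\<omega>^(2*k)" "inverse (\<omega>^(2*k))" i j] g(1) that
      by (simp add: Ggen1_def flip: *)
    moreover have "f (j, i) = (-1)^(i*j) * (\<omega>^n)^(i+j) * f (i, j)" for i j
      using mat2_act_antidiag[OF fA, of "\<omega>^n" "\<omega>^n" j i] g(2)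
      by (simp add: Ggen2_def power_add mult_ac)
    ultimately show "f \<in> swap_sym n (\<omega>^n)" using fA unfolding swap_sym_def by blast
  qed
qed

section \<open>Continued fractions and lattice points in a cone\<close>

lemma hj_val_Cons: "xs \<noteq> [] \<Longrightarrow> hj_val (a # xs) = of_int a - 1 / hj_val xs"
  by (cases xs) simp_all

lemma hj_val_gt_1: "xs \<noteq> [] \<Longrightarrow> \<forall>x\<in>set xs. x \<ge> 2 \<Longrightarrow> hj_val xs > 1"
proof (induction xs)
  case (Cons a xs)
  show ?case
  proof (cases "xs = []")
    case True with Cons show ?thesis by simp
  next
    case False
    with Cons have h: "hj_val xs > 1" by simp
    then have "1 / hj_val xs < 1" by simp
    moreover have "of_int a \<ge> (2::rat)" using Cons.prems by simp
    ultimately show ?thesis by (simp add: hj_val_Cons[OF False])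
  qed
qed simp

lemma additive_closed_mult:
  fixes T :: "int \<Rightarrow> int \<Rightarrow> bool"
  assumes "T 0 0" "\<And>a b c d. T a b \<Longrightarrow> T c d \<Longrightarrow> T (a + c) (b + d)" "T x y" "m \<ge> 0"
  shows "T (m * x) (m * y)"
  using assms(4)
proof (induction m rule: int_ge_induct)
  case base show ?case using assms(1) by simp
next
  case (step m)
  from assms(2)[OF assms(3) step.IH] show ?case by (simp add: algebra_simps)
qed

text \<open>The rays through the vectors \<open>(S i, R i)\<close> subdivide the cone; a point with negative
  first coordinate relative to two consecutive vectors lies beyond the second one.\<close>
lemma hj_cone:
  fixes S R :: "nat \<Rightarrow> int" and T :: "int \<Rightarrow> int \<Rightarrow> bool"
  assumes "T 0 0" and add: "\<And>a b c d. T a b \<Longrightarrow> T c d \<Longrightarrow> T (a + c) (b + d)"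
    and "\<forall>x\<in>set bs. x \<ge> 2"
    and "\<And>i. i < length bs \<Longrightarrow> S (i + 2) = bs ! i * S (i + 1) - S i"
    and "\<And>i. i < length bs \<Longrightarrow> R (i + 2) = bs ! i * R (i + 1) - R i"
    and "\<And>i. 1 \<le> i \<Longrightarrow> i \<le> length bs + 1 \<Longrightarrow> T (S i) (R i)"
    and "\<And>a b. a \<ge> 0 \<Longrightarrow> b > 0 \<Longrightarrow> T (a * S 0 + b * S 1) (a * R 0 + b * R 1)"
    and "b > 0" and "if bs = [] then a \<ge> 0 else of_int a * hj_val bs + of_int b \<ge> 0"
  shows "T (a * S 0 + b * S 1) (a * R 0 + b * R 1)"
  using assms(3-)
proof (induction bs arbitrary: S R a b)
  case Nil
  then show ?case by simp
next
  case (Cons c bs)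
  note mult = additive_closed_mult[of T, OF \<open>T 0 0\<close> add]
  show ?case
  proof (cases "a \<ge> 0")
    case True
    then show ?thesis using Cons.prems(5)[of a b] Cons.prems(6) by simp
  next
    case False
    \<comment> \<open>Coordinates with respect to the next two vectors. As \<open>a\<close> is
      negative here, the new second coordinate is positive, and the new first one may again be
      negative.\<close>
    have eq: "a * X 0 + b * X 1 = (b + a * c) * X (Suc 0) + (- a) * X (Suc 1)"
      if "X (Suc 1) = c * X 1 - X 0" for X :: "nat \<Rightarrow> int"
      unfolding that by (simp add: algebra_simps)
    have S: "S (Suc 1) = c * S 1 - S 0" and R: "R (Suc 1) = c * R 1 - R 0"
      using Cons.prems(2)[of 0] Cons.prems(3)[of 0] by (simp_all add: numeral_2_eq_2)
    show ?thesis unfolding eq[of S, OF S] eq[of R, OF R]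
    proof (rule Cons.IH[where S="\<lambda>i. S (Suc i)" and R="\<lambda>i. R (Suc i)"])
      show "\<forall>x\<in>set bs. 2 \<le> x" using Cons.prems(1) by simp
      show "S (Suc (i + 2)) = bs ! i * S (Suc (i + 1)) - S (Suc i)" if "i < length bs" for i
        using Cons.prems(2)[of "Suc i"] that by simp
      show "R (Suc (i + 2)) = bs ! i * R (Suc (i + 1)) - R (Suc i)" if "i < length bs" for i
        using Cons.prems(3)[of "Suc i"] that by simp
      show "T (S (Suc i)) (R (Suc i))" if "1 \<le> i" "i \<le> length bs + 1" for i
        using Cons.prems(4)[of "Suc i"] that by simp
      \<comment> \<open>Both vectors of the shifted cone satisfy \<open>T\<close>; only the vector
        at index 0 of the original sequence may fail to.\<close>
      show "T (x * S (Suc 0) + y * S (Suc 1)) (x * R (Suc 0) + y * R (Suc 1))"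
        if "x \<ge> 0" "y > 0" for x y
        using that Cons.prems(4)[of 1] Cons.prems(4)[of "Suc 1"] by (intro add mult) auto
      show "- a > 0" using False by simp
      show "if bs = [] then 0 \<le> b + a * c
            else 0 \<le> of_int (b + a * c) * hj_val bs + of_int (- a)"
      proof (cases "bs = []")
        case True
        with Cons.prems(7) have "(0::rat) \<le> of_int (b + a * c)" by (simp add: add.commute)
        with True show ?thesis by (simp only: of_int_0_le_iff refl if_True)
      next
        case nonempty: False
        with Cons.prems(1) have y: "hj_val bs > 1" by (intro hj_val_gt_1) auto
        \<comment> \<open>Multiplying by the tail of the continued fraction, which is positive,
          clears the inner fraction.\<close>
        have "0 \<le> (of_int a * (of_int c - 1 / hj_val bs) + of_int b) * hj_val bs"
          using Cons.prems(7) y by (simp add: hj_val_Cons[OF nonempty])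
        also have "\<dots> = of_int (b + a * c) * hj_val bs + of_int (- a)"
          using y by (simp add: field_simps)
        finally show ?thesis using nonempty by simp
      qed
    qed
  qed
qed

text \<open>The ratios of consecutive values are the successive tails of the continued fraction, all
  greater than 1, so the sign is handed on until the value at \<open>length bs + 1\<close>, which is
  0. It is applied to a linear functional on the vectors of the recurrence.\<close>

lemma hj_nonneg:
  fixes F :: "nat \<Rightarrow> rat"
  assumes "\<forall>x\<in>set bs. x \<ge> 2"
    and "\<And>i. i < length bs \<Longrightarrow> F (i + 2) = of_int (bs ! i) * F (i + 1) - F i"
    and "F 0 \<ge> 0" and "if bs = [] then F 1 = 0 else F 0 = F 1 * hj_val bs"
    and "i \<le> length bs + 1"
  shows "F i \<ge> 0"
  using assms
proof (induction bs arbitrary: F i)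
  case Nil
  then show ?case by (cases i) auto
next
  case (Cons c bs)
  have c: "hj_val (c # bs) > 1" using Cons.prems(1) by (intro hj_val_gt_1) auto
  have F0: "F 0 = F 1 * hj_val (c # bs)" using Cons.prems(4) by simp
  with c Cons.prems(3) have F1: "F 1 \<ge> 0" by (simp add: zero_le_mult_iff)
  show ?case
  proof (cases i)
    case 0 with Cons.prems show ?thesis by simp
  next
    case (Suc m)
    have F2: "F (Suc 1) = of_int c * F 1 - F 0"
      using Cons.prems(2)[of 0] by (simp add: numeral_2_eq_2)
    have "F (Suc m) \<ge> 0"
    proof (rule Cons.IH[where F="\<lambda>i. F (Suc i)"])
      show "\<forall>x\<in>set bs. 2 \<le> x" using Cons.prems(1) by simp
      show "F (Suc (i + 2)) = of_int (bs ! i) * F (Suc (i + 1)) - F (Suc i)" if "i < length bs" for i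
        using Cons.prems(2)[of "Suc i"] that by simp
      show "0 \<le> F (Suc 0)" using F1 by simp
      show "m \<le> length bs + 1" using Cons.prems(5) Suc by simp
      show "if bs = [] then F (Suc 1) = 0 else F (Suc 0) = F (Suc 1) * hj_val bs"
      proof (cases "bs = []")
        case True
        with F0 F2 show ?thesis by simp
      next
        case False
        with Cons.prems(1) have "hj_val bs > 1" by (intro hj_val_gt_1) auto
        \<comment> \<open>From \<open>F 0 = F 1 * (c - 1 / h)\<close> with \<open>h\<close> the tail
          value, \<open>F 1 / h\<close> equals \<open>c * F 1 - F 0\<close>, which is
          \<open>F 2\<close>.\<close>
        then have "F 1 = (of_int c * F 1 - F 0) * hj_val bs"
          unfolding F0 hj_val_Cons[OF False] by (simp add: field_simps)
        with False F2 show ?thesis by simp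
      qed
    qed
    with Suc show ?thesis by simp
  qed
qed

text \<open>Entries at least 2 keep the increments from shrinking: for positive
  \<open>S (i + 1)\<close>, the recurrence gives
  \<open>S (i + 2) - S (i + 1) \<ge> S (i + 1) - S i\<close>.\<close>

lemma hj_increasing:
  fixes S :: "nat \<Rightarrow> int"
  assumes "\<forall>x\<in>set bs. x \<ge> 2"
    and "\<And>i. i < length bs \<Longrightarrow> S (i + 2) = bs ! i * S (i + 1) - S i"
    and "S 0 = 0" "S 1 = 1" and "i \<le> length bs"
  shows "S (Suc i) \<ge> 1 \<and> S (Suc i) > S i"
  using assms(5)
proof (induction i)
  case 0 then show ?case using assms by simp
next
  case (Suc i)
  then have IH: "S (Suc i) \<ge> 1" "S (Suc i) > S i" by auto
  have "bs ! i \<ge> 2" using assms(1) Suc.prems by simp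
  then have "2 * S (Suc i) \<le> bs ! i * S (Suc i)" using IH by (intro mult_right_mono) auto
  with IH have "1 \<le> bs ! i * S (Suc i) - S i \<and> S (Suc i) < bs ! i * S (Suc i) - S i" by linarith
  with assms(2)[of i] Suc.prems show ?case by simp
qed

section \<open>Symmetry and leading terms of the generators\<close>

lemma even_rec2_diff:
  assumes "even (a1 - b1)" "even (a2 - b2)"
  shows "even (rec2 \<beta> a1 a2 i - rec2 \<beta> b1 b2 i)"
  using assms by (induction \<beta> a1 a2 i rule: rec2.induct) simp_all

text \<open>The exchange rule forces the second coefficient to be
  \<open>(-1)^((N+r)*r) * \<eta>^(N+2*r)\<close>, and \<open>N + 2 * r = k * t\<close> turns the
  power of \<eta> into \<open>(-1)^t\<close>. The condition \<open>N > 0\<close> keeps the two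
  monomials apart.\<close>

lemma two_term_swap_sym:
  fixes \<eta> :: "'k::field"
  assumes N: "n dvd N" "N > 0" and t: "N + 2 * r = k * t" and \<eta>: "\<eta>^k = -1"
  defines "B \<equiv> skadd (skmon (N+r) r) (sksmult ((-1)^((N+r)*r) * (-1)^t) (skmon r (N+r)))"
  shows "B \<in> swap_sym n \<eta>" and "leads B (N+r, r)"
proof -
  define e :: 'k where "e = (-1)^((N+r)*r) * (-1)^t"
  have B: "B (i, j) = (if i = N+r \<and> j = r then 1 else if i = r \<and> j = N+r then e else 0)" for i j
    using N by (auto simp: B_def skadd_def sksmult_def skmon_def e_def)
  have "\<eta>^(N + r + r) = \<eta>^(k * t)" using t by (simp add: mult_2 add.assoc)
  also have "\<dots> = (-1)^t" by (simp add: power_mult \<eta>)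
  finally have \<eta>t: "\<eta>^(N + r + r) = (-1)^t" .
  have ee: "e * e = 1"
    by (simp add: e_def flip: power_add)
  have "B (j, i) = (-1)^(i*j) * \<eta>^(i+j) * B (i, j)" for i j
  proof -
    consider "i = N+r \<and> j = r" | "i = r \<and> j = N+r" | "B (i, j) = 0" "B (j, i) = 0"
      unfolding B by (cases "i = N+r \<and> j = r"; cases "i = r \<and> j = N+r") auto
    then show ?thesis
    proof cases
      case 1
      then show ?thesis using N by (auto simp: B \<eta>t e_def)
    next
      case 2
      have "(-1)^(i*j) * \<eta>^(i+j) = e"
        using 2 \<eta>t by (simp add: e_def mult.commute add.commute add.left_commute)
      with 2 ee N show ?thesis by (auto simp: B)
    qed simp
  qed
  moreover have "int n dvd int i - int j" if "B (i, j) \<noteq> 0" for i j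
    using that N(1) by (auto simp: B split: if_splits)
  moreover have "B \<in> skA"
    unfolding B_def by (intro skA_skadd skA_sksmult skA_skmon)
  ultimately show "B \<in> swap_sym n \<eta>" unfolding swap_sym_def by blast
  have "q = (N+r, r) \<or> diff2 q < diff2 (N+r, r)" if "B q \<noteq> 0" for q
    using that N(2) by (cases q) (auto simp: B diff2_def split: if_splits)
  then show "leads B (N+r, r)" unfolding leads_def by (simp add: B)
qed

lemma leads_sksmult: "c \<noteq> 0 \<Longrightarrow> leads f p \<Longrightarrow> leads (sksmult c f) p"
  by (simp add: leads_def sksmult_def)

text \<open>Moving \<open>v^N\<close> past \<open>u^r\<close> costs \<open>(-1)^(N*r)\<close>. As
  \<open>k\<close> is odd, \<open>t\<close> and \<open>N\<close> have the same parity, and the sign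
  built into \<open>xgen\<close> becomes the coefficient required by
  \<open>two_term_swap_sym\<close>.\<close>

lemma xgen_swap_sym_leads:
  fixes \<eta> :: "'k::field"
  assumes "odd n" "odd k" and s: "sseq gs i \<ge> 1"
    and st: "int n * sseq gs i \<le> int k * tseq gs i" "even (tseq gs i - sseq gs i)"
    and \<eta>: "\<eta>^k = -1"
  shows "xgen n k gs i \<in> swap_sym n \<eta> \<and>
    (\<exists>a b. leads (xgen n k gs i :: 'k skpoly) (a, b) \<and>
      int a + int b = int k * tseq gs i \<and> int a - int b = int n * sseq gs i)"
proof -
  define N where "N = nat (int n * sseq gs i)"
  define r where "r = nat (rseq n k gs i)"
  define t where "t = nat (tseq gs i)"
  have n: "n > 0" and k: "k > 0" using assms by (auto intro: Nat.gr0I)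
  have N: "int N = int n * sseq gs i" using s by (simp add: N_def)
  have "0 \<le> int n * sseq gs i" using s by simp
  with st(1) have "0 \<le> int k * tseq gs i" by linarith
  with k have t: "int t = tseq gs i" by (simp add: t_def zero_le_mult_iff)
  \<comment> \<open>This makes the \<open>div 2\<close> in \<open>rseq\<close> exact.\<close>
  have ev: "even (int k * tseq gs i - int n * sseq gs i)" using st(2) assms(1,2) by simp
  have r: "int r = rseq n k gs i" "2 * int r = int k * tseq gs i - int n * sseq gs i"
    using st(1) ev by (simp_all add: r_def rseq_def)
  have Nrt: "N + 2 * r = k * t"
  proof -
    have "int (N + 2 * r) = int (k * t)" using N r t by simp
    then show ?thesis by (simp only: of_nat_eq_iff)
  qed
  have sgn: "(if even (rseq n k gs i + int n * sseq gs i) then 1 else -1) * (-1)^(N*r) =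
     (-1::'k)^((N+r)*r) * (-1)^t"
  proof -
    define p where "p \<longleftrightarrow> even (rseq n k gs i + int n * sseq gs i)"
    have "p \<longleftrightarrow> even (r + N)"
      unfolding p_def r(1)[symmetric] N[symmetric] by presburger
    moreover have "even t \<longleftrightarrow> even N"
      using Nrt assms(2) by (metis even_add even_mult_iff even_numeral)
    ultimately show ?thesis unfolding p_def[symmetric]
      by (cases "even r"; cases "even N") simp_all
  qed
  obtain c :: 'k where c: "c \<noteq> 0" "skpow (skmul sku skv) r = sksmult c (skmon r r)"
    using skpow_uv by blast
  let ?B = "skadd (skmon (N+r) r) (sksmult ((-1)^((N+r)*r) * (-1)^t) (skmon r (N+r))) :: 'k skpoly"
  have x: "xgen n k gs i = sksmult c ?B"
    unfolding xgen_def N_def[symmetric] r_def[symmetric] c(2) skpow_sku skpow_skv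
      skmul_sksmult_right skmul_skadd_left skmul_sksmult_left skmul_skmon_skmon sksmult_sksmult sgn
    by (simp add: sksmult_1)
  have "n dvd N"
  proof -
    have "int n dvd int N" unfolding N by simp
    then show ?thesis by simp
  qed
  moreover have "N > 0" using N n s by (simp add: N_def)
  ultimately have B: "?B \<in> swap_sym n \<eta>" "leads ?B (N+r, r)"
    using two_term_swap_sym[OF _ _ Nrt \<eta>] by blast+
  have "int (N+r) + int r = int k * tseq gs i" "int (N+r) - int r = int n * sseq gs i"
    using N r by simp_all
  with B c(1) show ?thesis unfolding x by (blast intro: swap_sym_sksmult leads_sksmult)
qed

text \<open>On the diagonal the exchange rule is a scalar condition: the exponent \<open>2*k\<close>
  is even, so the sign is 1, and \<open>\<eta>^(4*k) = 1\<close>. This element realizes the pair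
  \<open>(0, 4)\<close>.\<close>

lemma uv_power_swap_sym_leads:
  fixes \<eta> :: "'k::field"
  assumes \<eta>: "\<eta>^k = -1"
  shows "skpow (skmul sku skv) (2*k) \<in> swap_sym n \<eta>"
    and "leads (skpow (skmul sku skv) (2*k) :: 'k skpoly) (2*k, 2*k)"
proof -
  obtain c :: 'k where c: "c \<noteq> 0" "skpow (skmul sku skv) (2*k) = sksmult c (skmon (2*k) (2*k))"
    using skpow_uv by blast
  have "\<eta>^(k * 4) = 1" by (simp only: power_mult \<eta>) simp
  then have "\<eta>^(2*k + 2*k) = 1" by (simp add: mult.commute)
  then have "skmon (2*k) (2*k) \<in> swap_sym n \<eta>"
    using skA_skmon by (auto simp: swap_sym_def skmon_def)
  then show "skpow (skmul sku skv) (2*k) \<in> swap_sym n \<eta>" unfolding c by (rule swap_sym_sksmult)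
  show "leads (skpow (skmul sku skv) (2*k) :: 'k skpoly) (2*k, 2*k)"
    unfolding c by (intro leads_sksmult c(1)) (simp add: leads_def skmon_def)
qed

section \<open>The continued fraction attached to n and k\<close>

text \<open>The value lies strictly between 1 and 2, which excludes a single integer. The tail
  exceeds 1, so the first entry lies strictly between 1 and 3, and solving for the tail gives its
  value.\<close>

lemma HJ_shape:
  assumes k: "1 \<le> k" "k < n" and gs: "is_HJ gs" "hj_val gs = of_nat (2*n) / of_nat (n + k)"
  obtains c bs where "gs = 2 # c # bs" "\<forall>x\<in>set (c # bs). x \<ge> 2"
    "hj_val (c # bs) = of_nat (n + k) / of_nat (2*k)"
proof -
  obtain a xs where a: "gs = a # xs" "\<forall>x\<in>set xs. x \<ge> 2"
    using gs(1) by (cases gs) (auto simp: is_HJ_def)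
  have v: "1 < hj_val gs" "hj_val gs < 2" using k by (simp_all add: gs(2) field_simps)
  have ne: "xs \<noteq> []"
  proof
    assume "xs = []"
    with v a have "(1::rat) < of_int a" "of_int a < (2::rat)" by simp_all
    then show False by simp
  qed
  with a have h: "hj_val xs > 1" by (intro hj_val_gt_1)
  have va: "hj_val gs = of_int a - 1 / hj_val xs" by (simp add: a(1) hj_val_Cons[OF ne])
  have "1 / hj_val xs < 1" "1 / hj_val xs > 0" using h by simp_all
  with v va have "(1::rat) < of_int a" "of_int a < (3::rat)" by linarith+
  then have a2: "a = 2" by simp
  have "1 / hj_val xs = 2 - of_nat (2*n) / of_nat (n + k)" using va gs(2) a2 by simp
  also have "\<dots> = of_nat (2*k) / of_nat (n + k)" using k by (simp add: field_simps)
  finally have "hj_val xs = of_nat (n + k) / of_nat (2*k)" using h k by (simp add: field_simps)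
  moreover obtain c bs where "xs = c # bs" using ne by (cases xs) auto
  ultimately show ?thesis using that a a2 by blast
qed

text \<open>Dropping the first generator and prepending \<open>(0, 2)\<close> turns \<open>(s\<^sub>i, t\<^sub>i)\<close> into the
  sequence of vectors defined by the unmodified continued fraction of \<open>(n + k) / (2k)\<close>.\<close>
lemma sseq_tseq_recurrence:
  assumes gs_def: "gs = 2 # c # bs"
    and S_def: "S = (\<lambda>i. if i = 0 then 0 else sseq gs (i + 1))"
    and R_def: "R = (\<lambda>i. if i = 0 then 2 else tseq gs (i + 1))"
    and "i < length bs"
  shows "S (i + 2) = bs ! i * S (i + 1) - S i" "R (i + 2) = bs ! i * R (i + 1) - R i"
proof -
  \<comment> \<open>At \<open>i = 0\<close> the shift of the third entry is what is needed: since
    \<open>(s1, t1) = (s2, t2) + (0, 2)\<close>, adding 1 to the entry replaces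
    \<open>(s1, t1)\<close> by \<open>(0, 2)\<close> in the recurrence.\<close>
  show "S (i + 2) = bs ! i * S (i + 1) - S i"
    by (cases i)
      (simp_all add: S_def gs_def sseq_def bet_def gam_def numeral_2_eq_2 numeral_3_eq_3)
  show "R (i + 2) = bs ! i * R (i + 1) - R i"
    by (cases i)
      (simp_all add: R_def gs_def tseq_def bet_def gam_def numeral_2_eq_2 numeral_3_eq_3 algebra_simps)
qed

text \<open>The functional \<open>k * t - n * s\<close> satisfies the recurrence of the vectors, and
  the continued fraction fixes the ratio of its first two values, so \<open>hj_nonneg\<close>
  applies. The first generator lies outside the shifted sequence; it exceeds the second by
  \<open>(0, 2)\<close>.\<close>

lemma HJ_generators_in_cone:
  assumes k: "1 \<le> k" and gs: "gs = 2 # c # bs" "\<forall>x\<in>set (c # bs). x \<ge> 2"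
    and v: "hj_val (c # bs) = of_nat (n + k) / of_nat (2*k)"
    and i: "1 \<le> i" "i \<le> length gs"
  shows "sseq gs i \<ge> 1 \<and> int n * sseq gs i \<le> int k * tseq gs i"
proof -
  define S where "S = (\<lambda>i. if i = 0 then 0 else sseq gs (i + 1))"
  define R where "R = (\<lambda>i. if i = 0 then 2 else tseq gs (i + 1))"
  note rec = sseq_tseq_recurrence[OF gs(1) S_def R_def]
  have 1: "sseq gs (Suc 0) = 1" "tseq gs (Suc 0) = 2 * c + 1"
    "sseq gs (Suc (Suc 0)) = 1" "tseq gs (Suc (Suc 0)) = 2 * c - 1"
    by (simp_all add: sseq_def tseq_def bet_def gam_def gs(1))
  have bs: "\<forall>x\<in>set bs. x \<ge> 2" using gs(2) by simp
  define F :: "nat \<Rightarrow> rat" where "F = (\<lambda>i. of_nat k * of_int (R i) - of_nat n * of_int (S i))"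
  have F1: "F 1 = of_nat k * (2 * of_int c - 1) - of_nat n" by (simp add: F_def R_def S_def 1)
  have F: "F j \<ge> 0" if "j \<le> length bs + 1" for j
  proof (rule hj_nonneg[OF bs _ _ _ that])
    show "F (i + 2) = of_int (bs ! i) * F (i + 1) - F i" if "i < length bs" for i
      unfolding F_def rec[OF that] by (simp add: algebra_simps)
    show "F 0 \<ge> 0" by (simp add: F_def R_def S_def)
    show "if bs = [] then F 1 = 0 else F 0 = F 1 * hj_val bs"
    proof (cases "bs = []")
      case True
      then show ?thesis unfolding F1 using v k by (simp add: field_simps)
    next
      case False
      with bs have h: "hj_val bs > 1" by (intro hj_val_gt_1)
      have "of_int c = 1 / hj_val bs + of_nat (n + k) / of_nat (2*k)"
        using v hj_val_Cons[OF False] by (simp add: algebra_simps)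
      then have "F 1 = 2 * of_nat k / hj_val bs" unfolding F1 using k by (simp add: field_simps)
      moreover have "F 0 = 2 * of_nat k" by (simp add: F_def R_def S_def)
      ultimately show ?thesis using False h by simp
    qed
  qed
  have S1: "S (Suc j) \<ge> 1" if "j \<le> length bs" for j
    using hj_increasing[OF bs rec(1) _ _ that] by (simp add: S_def 1)
  have to_int: "int n * y \<le> int k * x" if "of_nat k * of_int x - of_nat n * of_int y \<ge> (0::rat)" for x y
  proof -
    have "(of_int (int n * y) :: rat) \<le> of_int (int k * x)" using that by simp
    then show ?thesis by (simp only: of_int_le_iff)
  qed
  show ?thesis
  proof (cases "i = 1")
    case True
    have "F 1 \<ge> 0" by (rule F) simp
    then have "int n * 1 \<le> int k * (2 * c - 1)" unfolding F1 by (intro to_int) simp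
    then show ?thesis using True k by (simp add: 1 algebra_simps)
  next
    case False
    then obtain j where j: "i = Suc (Suc j)" using i by (metis One_nat_def Suc_le_D le_antisym not_less_eq_eq)
    then have "j \<le> length bs" using i gs(1) by simp
    with S1[of j] F[of "Suc j"] show ?thesis
      by (auto intro!: to_int simp: j F_def S_def R_def)
  qed
qed

text \<open>The vectors \<open>(0, 2)\<close> and \<open>(1, 2 * c - 1)\<close> form a basis of the
  lattice of pairs of equal parity. In this basis \<open>(s, t)\<close> has coordinates
  \<open>a\<close> and \<open>s\<close>, and \<open>n * s \<le> k * t\<close> becomes the condition
  on coordinates in \<open>hj_cone\<close>.\<close>

lemma HJ_generate_cone:
  assumes k: "1 \<le> k" and gs: "gs = 2 # c # bs" "\<forall>x\<in>set (c # bs). x \<ge> 2"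
    and v: "hj_val (c # bs) = of_nat (n + k) / of_nat (2*k)"
    and T0: "T 0 0" and add: "\<And>a b c d. T a b \<Longrightarrow> T c d \<Longrightarrow> T (a + c) (b + d)"
    and T4: "T 0 4" and T: "\<And>i. 1 \<le> i \<Longrightarrow> i \<le> length gs \<Longrightarrow> T (sseq gs i) (tseq gs i)"
    and st: "s \<ge> 1" "even (t - s)" "int n * s \<le> int k * t"
  shows "T s t"
proof -
  define S where "S = (\<lambda>i. if i = 0 then 0 else sseq gs (i + 1))"
  define R where "R = (\<lambda>i. if i = 0 then 2 else tseq gs (i + 1))"
  note rec = sseq_tseq_recurrence[OF gs(1) S_def R_def]
  note mult = additive_closed_mult[of T, OF T0 add]
  have 1: "sseq gs (Suc 0) = 1" "tseq gs (Suc 0) = 2 * c + 1"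
    "sseq gs (Suc (Suc 0)) = 1" "tseq gs (Suc (Suc 0)) = 2 * c - 1"
    by (simp_all add: sseq_def tseq_def bet_def gam_def gs(1))
  have len: "length gs = Suc (Suc (length bs))" by (simp add: gs(1))
  have T1: "T 1 (2 * c + 1)" using T[of 1] by (simp add: 1 len)
  have T2: "T 1 (2 * c - 1)" using T[of 2] by (simp add: 1 len numeral_2_eq_2)
  have SR: "S 0 = 0" "R 0 = 2" "S 1 = 1" "R 1 = 2 * c - 1" by (simp_all add: S_def R_def 1)
  have bs: "\<forall>x\<in>set bs. x \<ge> 2" using gs(2) by simp
  define a where "a = (t - s * (2 * c - 1)) div 2"
  have "even (t - s * (2 * c - 1))" using st(2) by simp
  then have a: "t = 2 * a + s * (2 * c - 1)" by (simp add: a_def)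
  have st': "of_nat n * of_int s \<le> of_nat k * (of_int t :: rat)"
  proof -
    have "(of_int (int n * s) :: rat) \<le> of_int (int k * t)" using st(3) by (simp only: of_int_le_iff)
    then show ?thesis by simp
  qed
  have "T (a * S 0 + s * S 1) (a * R 0 + s * R 1)"
  proof (rule hj_cone[of T, OF T0 add bs])
    show "T (S i) (R i)" if "1 \<le> i" "i \<le> length bs + 1" for i
      using T[of "i + 1"] that gs(1) by (simp add: S_def R_def)
    show "T (x * S 0 + y * S 1) (x * R 0 + y * R 1)" if xy: "x \<ge> 0" "y > 0" for x y
    \<comment> \<open>Only even multiples of \<open>(0, 2)\<close> come from \<open>(0, 4)\<close>.
      For odd \<open>x\<close> the leftover \<open>(0, 2)\<close> is absorbed by turning one copy of
      \<open>(1, 2 * c - 1)\<close> into \<open>(1, 2 * c + 1)\<close>, which exists because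
      \<open>y > 0\<close>.\<close>
    proof (cases "even x")
      case True
      then obtain q where q: "x = 2 * q" by blast
      have "T (q * 0 + y * 1) (q * 4 + y * (2 * c - 1))"
        using xy q by (intro add mult T4 T2) auto
      then show ?thesis unfolding SR by (simp add: q algebra_simps)
    next
      case False
      then obtain q where q: "x = 2 * q + 1" by (rule oddE)
      have "T (q * 0 + ((y - 1) * 1 + 1)) (q * 4 + ((y - 1) * (2 * c - 1) + (2 * c + 1)))"
        using xy q by (intro add mult T4 T2 T1) auto
      then show ?thesis unfolding SR by (simp add: q algebra_simps)
    qed
    show "s > 0" using st(1) by simp
    show "if bs = [] then 0 \<le> a else 0 \<le> of_int a * hj_val bs + of_int s"
    proof (cases "bs = []")
      case True
      with v k have "of_nat n = of_nat k * (2 * of_int c - 1 :: rat)" by (simp add: field_simps)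
      then have "(of_int (int n) :: rat) = of_int (int k * (2 * c - 1))" by simp
      then have n: "int n = int k * (2 * c - 1)" by (simp only: of_int_eq_iff)
      have "int k * (s * (2 * c - 1)) \<le> int k * t" using st(3) unfolding n by (simp add: mult_ac)
      then have "s * (2 * c - 1) \<le> t" using k by simp
      with True a show ?thesis by simp
    next
      case False
      with bs have h: "hj_val bs > 1" by (intro hj_val_gt_1)
      have c: "of_int c = 1 / hj_val bs + of_nat (n + k) / of_nat (2*k)"
        using v hj_val_Cons[OF False] by (simp add: algebra_simps)
      have at: "of_int t = 2 * of_int a + of_int s * (2 * of_int c - 1 :: rat)"
        unfolding a by simp
      \<comment> \<open>The functional defining the cone, written in the coordinates
        \<open>a\<close> and \<open>s\<close>.\<close>
      have "2 * of_nat k * (of_int a + of_int s / hj_val bs) =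
          of_nat k * of_int t - of_nat n * of_int s"
        unfolding at c using k h by (simp add: field_simps)
      then have "0 \<le> 2 * of_nat k * (of_int a + of_int s / hj_val bs)" using st' by simp
      then have "0 \<le> of_int a + of_int s / hj_val bs" using k by (simp add: zero_le_mult_iff)
      then have "0 \<le> (of_int a + of_int s / hj_val bs) * hj_val bs" using h by simp
      also have "\<dots> = of_int a * hj_val bs + of_int s" using h by (simp add: distrib_right)
      finally show ?thesis using False by simp
    qed
  qed (use rec in auto)
  then show ?thesis unfolding SR by (simp add: a mult.commute)
qed

section \<open>Exponents of invariants and conclusion\<close>

lemma primitive_root_power_eq_1_iff:
  fixes \<omega> :: "'k::field"
  assumes "\<omega>^m = 1" "\<forall>j. 0 < j \<and> j < m \<longrightarrow> \<omega>^j \<noteq> 1" "m > 0"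
  shows "\<omega>^l = 1 \<longleftrightarrow> m dvd l"
proof -
  have "\<omega>^l = \<omega>^(m * (l div m) + l mod m)" by simp
  also have "\<dots> = \<omega>^(l mod m)" unfolding power_add power_mult by (simp add: assms(1))
  finally have "\<omega>^l = \<omega>^(l mod m)" .
  moreover have "l mod m < m" using assms(3) by simp
  ultimately show ?thesis using assms(2) by (metis bot_nat_0.not_eq_extremum dvd_eq_mod_eq_0 power_0)
qed

text \<open>Applying the exchange rule twice gives \<open>\<eta>^(2*(i+j)) = 1\<close>, hence
  \<open>k\<close> divides \<open>i + j\<close>. The parity statement reflects that
  \<open>i + j\<close> and \<open>i - j\<close> have equal parity while \<open>n\<close> and
  \<open>k\<close> are odd.\<close>

lemma swap_sym_support:
  fixes \<eta> :: "'k::field_char_0"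
  assumes "odd n" "odd k" and \<eta>: "\<And>m. \<eta>^m = 1 \<longleftrightarrow> 2 * k dvd m" "\<eta>^k = -1"
    and f: "f \<in> swap_sym n \<eta>" "f (i, j) \<noteq> 0"
  obtains s t where "int i - int j = int n * s" "i + j = k * t"
    "even (int t - s)" "s = 0 \<longrightarrow> 4 dvd t"
proof -
  have sw: "f (b, a) = (-1)^(a*b) * \<eta>^(a+b) * f (a, b)" for a b
    using f(1) unfolding swap_sym_def by blast
  obtain s where s: "int i - int j = int n * s" using f unfolding swap_sym_def by blast
  have "f (i, j) = (-1)^(j*i) * \<eta>^(j+i) * ((-1)^(i*j) * \<eta>^(i+j) * f (i, j))"
    using sw[of i j] sw[of j i] by argo
  also have "\<dots> = ((-1)^(i*j) * (-1)^(i*j)) * \<eta>^(2*(i+j)) * f (i, j)"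
    unfolding mult_2[of "i+j"] power_add by (simp only: mult_ac)
  also have "(-1::'k)^(i*j) * (-1)^(i*j) = 1" by (simp flip: power_add)
  finally have "\<eta>^(2*(i+j)) = 1" using f(2) by simp
  then have "k dvd i + j" unfolding \<eta>(1) by (simp del: distrib_left_numeral)
  then obtain t where t: "i + j = k * t" by blast
  have kt: "int k * int t = int i + int j" using t by (metis of_nat_add of_nat_mult)
  have "even (int k * int t + int n * s)" unfolding kt s[symmetric] by simp
  then have par: "even (int t - s)" using assms(1,2) by simp
  \<comment> \<open>For \<open>i = j\<close> the rule compares a coefficient with itself, so its
    sign must be 1. Thus \<open>i\<close> is even, 4 divides \<open>2 * i = k * t\<close>, and
    \<open>k\<close> is odd.\<close>
  have "4 dvd t" if "s = 0"
  proof -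
    have ij: "i = j" using s that by simp
    have "even t" using par that by simp
    have "\<eta>^(k * t) = 1" using \<open>even t\<close> by (simp add: power_mult \<eta>(2))
    with sw[of i j] t ij have "f (i, i) = (-1)^(i*i) * f (i, i)" by simp
    with f(2) ij have "(-1::'k)^(i*i) = 1" by simp
    then have "even i" by (cases "even i") simp_all
    then have "4 dvd k * t" using t ij by (metis dvd_mult_left even_iff_mod_2_eq_zero mult_2 mult_dvd_mono dvd_refl numeral_Bit0
         numeral_times_numeral)
    moreover have "coprime (2^2) k" using assms(2) by (simp only: coprime_power_left_iff coprime_left_2_iff_odd) simp
    ultimately show ?thesis by (simp add: coprime_dvd_mult_right_iff)
  qed
  with s t par that show ?thesis by blast
qed

theorem mainTheorem19:
  fixes n k :: nat and gs :: "int list" and \<omega> :: "'k::{alg_closed_field, field_char_0}"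
  assumes "1 \<le> k" and "k < n" and "odd n" and "odd k" and "coprime n k"
    and "\<omega> ^ (2*n*k) = 1" and "\<forall>j. 0 < j \<and> j < 2*n*k \<longrightarrow> \<omega> ^ j \<noteq> 1"
    and "is_HJ gs" and "hj_val gs = of_nat (2*n) / of_nat (n + k)"
  shows "invariant_ring \<omega> n k =
           alg_gen ({xgen n k gs i | i. 1 \<le> i \<and> i \<le> length gs}
                    \<union> {skpow (skmul sku skv) (2*k)})"
proof -
  have nk: "2*n*k > 0" using assms(1,2) by simp
  have \<omega>: "\<omega>^l = 1 \<longleftrightarrow> 2*n*k dvd l" for l
    using assms(6,7) nk by (rule primitive_root_power_eq_1_iff)
  have \<omega>0: "\<omega> \<noteq> 0" using assms(6) nk by (metis power_0_left neq0_conv zero_neq_one)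
  have inv: "invariant_ring \<omega> n k = swap_sym n (\<omega>^n)"
  proof (rule invariant_ring_eq_swap_sym[OF \<omega>0])
    fix m
    have "(2*k) * n dvd (2*k) * m \<longleftrightarrow> n dvd m" using assms(1) by (subst dvd_times_left_cancel_iff) auto
    then show "(\<omega>^(2*k))^m = 1 \<longleftrightarrow> n dvd m"
      by (simp add: \<omega> mult_ac flip: power_mult)
  qed
  define \<eta> where "\<eta> = \<omega>^n"
  have \<eta>: "\<eta>^m = 1 \<longleftrightarrow> 2*k dvd m" for m
  proof -
    have "n * (2*k) dvd n * m \<longleftrightarrow> 2*k dvd m" using assms(2) by (subst dvd_times_left_cancel_iff) auto
    then show ?thesis by (simp add: \<eta>_def \<omega> mult_ac flip: power_mult)
  qed
  \<comment> \<open>As \<eta> has order \<open>2*k\<close>, its \<open>k\<close>th power is a square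
    root of 1 other than 1.\<close>
  have "(\<eta>^k)^2 = 1" using \<eta>[of "2*k"] by (simp add: mult.commute flip: power_mult)
  moreover have "\<eta>^k \<noteq> 1" unfolding \<eta> using assms(1) by (auto dest: dvd_imp_le)
  ultimately have \<eta>k: "\<eta>^k = -1" by (simp add: power2_eq_1_iff)
  obtain c bs where gs: "gs = 2 # c # bs" "\<forall>x\<in>set (c # bs). x \<ge> 2"
    "hj_val (c # bs) = of_nat (n + k) / of_nat (2*k)"
    using HJ_shape[OF assms(1,2,8,9)] .
  define X :: "'k skpoly set" where "X = {xgen n k gs i | i. 1 \<le> i \<and> i \<le> length gs}
                    \<union> {skpow (skmul sku skv) (2*k)}"
  have xg: "xgen n k gs i \<in> swap_sym n \<eta> \<and>
      (\<exists>a b. leads (xgen n k gs i :: 'k skpoly) (a, b) \<and>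
      int a + int b = int k * tseq gs i \<and> int a - int b = int n * sseq gs i)"
    if "1 \<le> i" "i \<le> length gs" for i
  proof (rule xgen_swap_sym_leads[OF assms(3,4) _ _ _ \<eta>k])
    show "even (tseq gs i - sseq gs i)" unfolding tseq_def sseq_def by (rule even_rec2_diff) simp_all
  qed (use HJ_generators_in_cone[OF assms(1) gs that] in auto)
  have X: "X \<subseteq> swap_sym n \<eta>"
    unfolding X_def using xg uv_power_swap_sym_leads(1)[OF \<eta>k] by blast
  \<comment> \<open>The pair \<open>(s, t)\<close> encodes the monomial with difference
    \<open>n * s\<close> and total degree \<open>k * t\<close>; products of leading terms then make
    \<open>T\<close> additive.\<close>
  define T where "T s t \<longleftrightarrow> (\<exists>i j. (\<exists>m\<in>alg_gen X. leads m (i, j)) \<and>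
    int i + int j = int k * t \<and> int i - int j = int n * s)" for s t
  have T0: "T 0 0"
  proof -
    have "leads (skone :: 'k skpoly) (0, 0)" by (simp add: leads_def skone_def skmon_def)
    moreover have "(skone :: 'k skpoly) \<in> alg_gen X" using alg_gen.scal[of 1 X] by (simp add: sksmult_1)
    ultimately show ?thesis unfolding T_def by (intro exI[of _ 0]) auto
  qed
  have Tadd: "T (s + s') (t + t')" if T: "T s t" "T s' t'" for s t s' t'
  proof -
    from T(1) obtain i j m where 1: "m \<in> alg_gen X" "leads m (i, j)"
      "int i + int j = int k * t" "int i - int j = int n * s" unfolding T_def by blast
    from T(2) obtain i' j' m' where 2: "m' \<in> alg_gen X" "leads m' (i', j')"
      "int i' + int j' = int k * t'" "int i' - int j' = int n * s'" unfolding T_def by blast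
    have "int (i+i') + int (j+j') = int k * (t+t')" "int (i+i') - int (j+j') = int n * (s+s')"
      using 1 2 by (simp_all add: algebra_simps)
    with alg_gen.mul[OF 1(1) 2(1)] leads_skmul[OF 1(2) 2(2)] show ?thesis unfolding T_def by blast
  qed
  have T4: "T 0 4"
  proof -
    have "skpow (skmul sku skv) (2*k) \<in> alg_gen X" by (rule alg_gen.gen) (simp add: X_def)
    moreover have "int (2*k) + int (2*k) = int k * 4" "int (2*k) - int (2*k) = int n * 0" by simp_all
    ultimately show ?thesis using uv_power_swap_sym_leads(2)[OF \<eta>k] unfolding T_def by blast
  qed
  have Tx: "T (sseq gs i) (tseq gs i)" if "1 \<le> i" "i \<le> length gs" for i
  proof -
    have "xgen n k gs i \<in> alg_gen X" using that by (intro alg_gen.gen) (auto simp: X_def)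
    with xg[OF that] show ?thesis unfolding T_def by blast
  qed
  have "swap_sym n \<eta> \<subseteq> alg_gen X"
  proof (rule swap_sym_subset_alg_gen[OF X])
    fix f i j assume f: "f \<in> swap_sym n \<eta>" "f (i, j) \<noteq> 0" and ij: "j \<le> i"
    obtain s t where st: "int i - int j = int n * s" "i + j = k * t"
      "even (int t - s)" "s = 0 \<longrightarrow> 4 dvd t"
      using f by (rule swap_sym_support[OF assms(3,4) \<eta> \<eta>k])
    have kt: "int i + int j = int k * int t" using st(2) by (metis of_nat_add of_nat_mult)
    have "0 \<le> int n * s" using ij by (simp flip: st(1))
    then have s0: "s \<ge> 0" using assms(2) by (simp add: zero_le_mult_iff)
    have "T s (int t)"
    proof (cases "s = 0")
      case True
      then obtain q where "t = 4 * q" using st(4) by blast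
      with True additive_closed_mult[of T, OF T0 Tadd T4, of "int q"] show ?thesis
        by (simp add: mult.commute)
    next
      case False
      show ?thesis
      proof (rule HJ_generate_cone[OF assms(1) gs, of T, OF T0 Tadd T4 Tx])
        show "1 \<le> s" using False s0 by simp
        show "int n * s \<le> int k * int t" using st(1) kt by linarith
      qed (use st(3) in auto)
    qed
    then obtain i' j' where T: "\<exists>m\<in>alg_gen X. leads m (i', j')"
      "int i' + int j' = int k * int t" "int i' - int j' = int n * s" unfolding T_def by blast
    \<comment> \<open>Sum and difference determine both exponents, so the monomial provided by
      \<open>T\<close> is the given one.\<close>
    with st(1) kt have "i' = i" "j' = j" by linarith+
    with T(1) show "\<exists>m\<in>alg_gen X. leads m (i, j)" by simp
  qed
  with alg_gen_subset_swap_sym[OF X] have "swap_sym n \<eta> = alg_gen X" by blast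
  then show ?thesis by (simp only: inv X_def \<eta>_def)
qed

end
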